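(* Let $F$ be a field, let $A=(a_{ij})$ be an $n\times n$ matrix over $F$, let $b=[b_1,\ldots,b_n]^T\in F^n$, and let $k$ be a fixed integer with $0\le k\le n-1$. Let $I=(i_1,\ldots,i_k)$ and $J=(j_1,\ldots,j_k)$ be two ordered index lists in $N_n=(1,2,\ldots,n)$, with complementary ordered index lists $I'$ and $J'$. Suppose that the submatrix $$A_0=A\begin{bmatrix} I\\ J\end{bmatrix}=\begin{bmatrix} a_{i_1j_1} & \cdots & a_{i_1j_k}\\ \vdots & \ddots & \vdots\\ a_{i_kj_1} & \cdots & a_{i_kj_k}\end{bmatrix}$$ is invertible. Let $\hat C=(\hat c_{pq})_{p\in I',\,q\in J'}$ and $b^{(k)}=(b'_p)_{p\in I'}$ be the condensed matrix and right-hand side determined by $A_0$, namely $$\hat c_{pq}=\det\begin{bmatrix} & & & a_{i_1q}\\ & A_0 & & \vdots\\ & & & a_{i_kq}\\ a_{pj_1} & \cdots & a_{pj_k} & a_{pq}\end{bmatrix},\qquad b'_p=\det\begin{bmatrix} & & & b_{i_1}\\ & A_0 & & \vdots\\ & & & b_{i_k}\\ a_{pj_1} & \cdots & a_{pj_k} & b_p\end{bmatrix}.$$ Then the linear system $Ax=b$ has the same corresponding solutions as the linear system $\hat C x_{J'}=b^{(k)}$ in the unknowns $x_{J'}=(x_q)_{q\in J'}$; that is, a vector $y=(y_q)_{q\in J'}$ satisfies $\hat C y=b^{(k)}$ if and only if there is a solution $x=[x_1,\ldots,x_n]^T$ of $Ax=b$ with $x_q=y_q$ for all $q\in J'$.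
   Context: An ordered index list $I=(i_1,\ldots,i_t)\subset N_n=(1,2,\ldots,n)$ is a strictly increasing list of indices, i.e. $i_\alpha<i_\beta$ whenever $\alpha<\beta$. Its complementary ordered index list $I'$ is the strictly increasing list of the elements of $\{1,\ldots,n\}$ not in $I$, so $I\cup I'=N_n$ (similarly for $J$ and $J'$). For a vector $x$, $x_{J'}$ denotes the subvector of entries of $x$ with index in $J'$. The rows of $\hat C$ are indexed by $I'$ in increasing order and its columns by $J'$ in increasing order. For $k=0$, $A_0$ is the empty matrix (with determinant $1$), $\hat C=A$ and $b^{(k)}=b$. *)

theory Defs
  imports "Jordan_Normal_Form.Determinant" "Jordan_Normal_Form.DL_Submatrix"
begin

(* Indices are 0-based, as everywhere in Jordan_Normal_Form: N_n is [0..<n]. *)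

definition ordered_index_list :: "nat \<Rightarrow> nat list \<Rightarrow> bool" where
  "ordered_index_list n I \<longleftrightarrow> sorted_wrt (<) I \<and> set I \<subseteq> {0..<n}"

definition complement_list :: "nat \<Rightarrow> nat list \<Rightarrow> nat list" where
  "complement_list n I = filter (\<lambda>i. i \<notin> set I) [0..<n]"

definition subvec :: "'a vec \<Rightarrow> nat list \<Rightarrow> 'a vec" where
  "subvec x I = vec (length I) (\<lambda>r. x $ (I ! r))"

(* A[I; J].  The library's submatrix takes index sets and keeps the indices in increasing
   order, so for ordered index lists its (r,s) entry is A $$ (I ! r, J ! s); see
   list_submatrix_index below. *)
definition list_submatrix :: "'a mat \<Rightarrow> nat list \<Rightarrow> nat list \<Rightarrow> 'a mat" where
  "list_submatrix A I J = submatrix A (set I) (set J)"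

(* The block matrix [M, u; v^T, a]. *)
definition bordered_mat :: "'a::zero mat \<Rightarrow> 'a vec \<Rightarrow> 'a vec \<Rightarrow> 'a \<Rightarrow> 'a mat" where
  "bordered_mat M u v a =
     four_block_mat M (mat_of_cols (dim_row M) [u]) (mat_of_rows (dim_col M) [v])
       (mat 1 1 (\<lambda>_. a))"

(* The two entry functions take the original indices p in I' and q in J'; the condensed
   matrix and vector list these entries with p and q in increasing order. *)
definition condensed_entry ::
  "'a::comm_ring_1 mat \<Rightarrow> nat list \<Rightarrow> nat list \<Rightarrow> nat \<Rightarrow> nat \<Rightarrow> 'a" where
  "condensed_entry A I J p q =
     det (bordered_mat (list_submatrix A I J)
           (subvec (col A q) I) (subvec (row A p) J) (A $$ (p, q)))"

definition condensed_rhs_entry ::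
  "'a::comm_ring_1 mat \<Rightarrow> 'a vec \<Rightarrow> nat list \<Rightarrow> nat list \<Rightarrow> nat \<Rightarrow> 'a" where
  "condensed_rhs_entry A b I J p =
     det (bordered_mat (list_submatrix A I J)
           (subvec b I) (subvec (row A p) J) (b $ p))"

definition condensed_mat :: "'a::comm_ring_1 mat \<Rightarrow> nat list \<Rightarrow> nat list \<Rightarrow> 'a mat" where
  "condensed_mat A I J =
     (let I' = complement_list (dim_row A) I; J' = complement_list (dim_col A) J
      in mat (length I') (length J') (\<lambda>(r, s). condensed_entry A I J (I' ! r) (J' ! s)))"

definition condensed_rhs ::
  "'a::comm_ring_1 mat \<Rightarrow> 'a vec \<Rightarrow> nat list \<Rightarrow> nat list \<Rightarrow> 'a vec" where
  "condensed_rhs A b I J =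
     (let I' = complement_list (dim_row A) I
      in vec (length I') (\<lambda>r. condensed_rhs_entry A b I J (I' ! r)))"

lemma pick_ordered_index_list:
  assumes "ordered_index_list n I" and "r < length I"
  shows "pick (set I) r = I ! r"
proof -
  have s: "sorted_wrt (<) I"
    using assms(1) by (simp add: ordered_index_list_def)
  have "{a \<in> set I. a < I ! r} = (!) I ` {..<r}"
  proof
    show "{a \<in> set I. a < I ! r} \<subseteq> (!) I ` {..<r}"
    proof
      fix a assume "a \<in> {a \<in> set I. a < I ! r}"
      then obtain j where j: "j < length I" "a = I ! j" "I ! j < I ! r"
        by (auto simp: in_set_conv_nth)
      have "j < r"
      proof (rule ccontr)
        assume "\<not> j < r"
        then have "r = j \<or> I ! r < I ! j"
          using sorted_wrt_nth_less[OF s, of r j] j(1) by linarith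
        then show False using j(3) by auto
      qed
      then show "a \<in> (!) I ` {..<r}" using j by auto
    qed
    show "(!) I ` {..<r} \<subseteq> {a \<in> set I. a < I ! r}"
      using assms(2) sorted_wrt_nth_less[OF s, of _ r] by fastforce
  qed
  moreover have "distinct I"
    using s by (simp add: strict_sorted_iff)
  then have "inj_on ((!) I) {..<r}"
    using assms(2) by (simp add: inj_on_nth)
  ultimately have "card {a \<in> set I. a < I ! r} = r"
    by (simp add: card_image)
  then show ?thesis
    using pick_card_in_set[of "I ! r" "set I"] assms(2) by simp
qed

lemma card_ordered_index_list:
  assumes "ordered_index_list n I"
  shows "card {i. i < n \<and> i \<in> set I} = length I"
proof -
  have "{i. i < n \<and> i \<in> set I} = set I" and "distinct I"
    using assms by (auto simp: ordered_index_list_def strict_sorted_iff)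
  then show ?thesis by (simp add: distinct_card)
qed

lemma list_submatrix_carrier:
  assumes "A \<in> carrier_mat m n" and "ordered_index_list m I" and "ordered_index_list n J"
  shows "list_submatrix A I J \<in> carrier_mat (length I) (length J)"
  using assms(1) card_ordered_index_list[OF assms(2)] card_ordered_index_list[OF assms(3)]
  by (intro carrier_matI) (simp_all add: list_submatrix_def dim_submatrix carrier_matD)

lemma list_submatrix_index:
  assumes "A \<in> carrier_mat m n" and "ordered_index_list m I" and "ordered_index_list n J"
    and "r < length I" and "s < length J"
  shows "list_submatrix A I J $$ (r, s) = A $$ (I ! r, J ! s)"
proof -
  have "r < card {i. i < dim_row A \<and> i \<in> set I}" "s < card {j. j < dim_col A \<and> j \<in> set J}"
    using assms(1,4,5) card_ordered_index_list[OF assms(2)] card_ordered_index_list[OF assms(3)]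
    by (simp_all only: carrier_matD)
  then have "submatrix A (set I) (set J) $$ (r, s) = A $$ (pick (set I) r, pick (set J) s)"
    by (rule submatrix_index)
  then show ?thesis
    by (simp only: list_submatrix_def pick_ordered_index_list[OF assms(2,4)]
        pick_ordered_index_list[OF assms(3,5)])
qed

end

theory Submission
  imports Defs
begin

text \<open>
  Write \<open>A\<^sub>0\<close> for the invertible submatrix.  The condensed system consists, up to the factor
  \<open>det A\<^sub>0\<close>, of the equations that remain after block Gaussian elimination with pivot block
  \<open>A\<^sub>0\<close>.  Indeed, for each row \<open>p\<close> there is a unique combination \<open>w\<close> of the rows in \<open>I\<close> that agrees
  with row \<open>p\<close> in the columns \<open>J\<close>.  Subtracting this combination from the last row of a
  bordered matrix clears that row except for its corner, so the determinant is \<open>det A\<^sub>0\<close> times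
  the new corner entry (\<open>det_bordered_mat\<close>).

  Applied to all columns and to the right-hand side at once, this gives an identity valid for every
  vector \<open>x\<close> (\<open>condensed_residual\<close>): the residual of the condensed equation \<open>p\<close> at \<open>x\<^bsub>J'\<^esub>\<close> is
  \<open>det A\<^sub>0\<close> times the residual of equation \<open>p\<close> of \<open>A x = b\<close> minus a combination of the
  residuals of the equations in \<open>I\<close>.  Hence solutions of \<open>A x = b\<close> restrict to solutions of the condensed
  system.  Conversely, a vector \<open>y\<close> extends to an \<open>x\<close> that satisfies the equations in \<open>I\<close>,
  because these determine \<open>x\<^sub>J\<close> through the invertible \<open>A\<^sub>0\<close>; if \<open>y\<close> solves the condensed
  system, the identity and \<open>det A\<^sub>0 \<noteq> 0\<close> make all other residuals of \<open>x\<close> vanish too.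
\<close>

section \<open>Index lists and their complements\<close>

lemma ordered_index_list_distinct:
  assumes "ordered_index_list n I"
  shows "distinct I"
  using assms by (simp add: ordered_index_list_def strict_sorted_iff)

lemma ordered_index_list_nth_less:
  assumes "ordered_index_list n I" and "r < length I"
  shows "I ! r < n"
  using assms by (force simp: ordered_index_list_def dest: nth_mem)

lemma set_complement_list: "set (complement_list n I) = {0..<n} - set I"
  by (auto simp: complement_list_def)

lemma distinct_complement_list: "distinct (complement_list n I)"
  by (simp add: complement_list_def)

lemma length_complement_list:
  assumes "ordered_index_list n I"
  shows "length (complement_list n I) = n - length I"
proof -
  have "length (complement_list n I) = card ({0..<n} - set I)"
    using distinct_card[OF distinct_complement_list] by (metis set_complement_list)
  also have "\<dots> = n - length I"
    using assms ordered_index_list_distinct[OF assms]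
    by (simp add: card_Diff_subset ordered_index_list_def distinct_card)
  finally show ?thesis .
qed

lemma sum_nth_distinct:
  assumes "distinct L"
  shows "(\<Sum>s = 0..<length L. f (L ! s)) = sum f (set L)"
  using assms by (intro sum.reindex_bij_betw bij_betw_nth) auto

lemma sum_split_complement_list:
  assumes "ordered_index_list n J"
  shows "sum f {0..<n} =
    (\<Sum>s = 0..<length J. f (J ! s)) +
    (\<Sum>s = 0..<length (complement_list n J). f (complement_list n J ! s))"
proof -
  have "sum f {0..<n} = sum f ({0..<n} - set J) + sum f (set J)"
    using assms by (intro sum.subset_diff) (auto simp: ordered_index_list_def)
  then show ?thesis
    by (simp only: sum_nth_distinct[OF ordered_index_list_distinct[OF assms]]
        sum_nth_distinct[OF distinct_complement_list] set_complement_list add.commute)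
qed

text \<open>A vector can be prescribed freely on \<open>J\<close> and on \<open>J'\<close>, since their concatenation
  enumerates all indices without repetition.\<close>

lemma exists_vec_with_subvecs:
  assumes J: "ordered_index_list n J"
    and z: "z \<in> carrier_vec (length J)" and y: "y \<in> carrier_vec (n - length J)"
  obtains x where "x \<in> carrier_vec n" "subvec x J = z" "subvec x (complement_list n J) = y"
proof -
  define J' where "J' = complement_list n J"
  have len: "length J' = n - length J"
    unfolding J'_def by (rule length_complement_list[OF J])
  define g where "g = (\<lambda>i. the (map_of (zip (J @ J') (list_of_vec (z @\<^sub>v y))) i))"
  have d: "distinct (J @ J')"
    using ordered_index_list_distinct[OF J] distinct_complement_list
    by (auto simp: J'_def set_complement_list)
  have g: "g ((J @ J') ! t) = (z @\<^sub>v y) $ t" if "t < length J + length J'" for t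
  proof -
    have "length (J @ J') = length (list_of_vec (z @\<^sub>v y))"
      using z y len by simp
    then have "g ((J @ J') ! t) = list_of_vec (z @\<^sub>v y) ! t"
      using map_of_zip_nth[OF _ d, of "list_of_vec (z @\<^sub>v y)" t] that
      by (simp only: g_def option.sel length_append)
    also have "\<dots> = (z @\<^sub>v y) $ t"
      by (rule list_of_vec_index)
    finally show ?thesis .
  qed
  show thesis
  proof
    show "vec n g \<in> carrier_vec n" by simp
    show "subvec (vec n g) J = z"
    proof (rule eq_vecI)
      fix s assume "s < dim_vec z"
      then show "subvec (vec n g) J $ s = z $ s"
        using g[of s] z ordered_index_list_nth_less[OF J, of s]
        by (simp add: subvec_def nth_append)
    qed (use z in \<open>simp add: subvec_def\<close>)
    show "subvec (vec n g) (complement_list n J) = y"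
    proof (rule eq_vecI)
      fix s assume "s < dim_vec y"
      then have s: "s < length J'" using y len by simp
      then have "J' ! s < n"
        using nth_mem[OF s] by (simp add: J'_def set_complement_list)
      then show "subvec (vec n g) (complement_list n J) $ s = y $ s"
        using g[of "length J + s"] s z y len
        by (simp add: subvec_def nth_append J'_def)
    qed (use y len in \<open>simp add: subvec_def J'_def\<close>)
  qed
qed

section \<open>Determinants of bordered matrices\<close>

text \<open>The border row is the combination of the rows of \<open>M\<close> with coefficients \<open>w\<close>.  Subtracting the
  same combination of the full rows is multiplication from the left by a
  unitriangular matrix; it leaves a block upper triangular matrix with the corner \<open>a - w \<bullet> u\<close>.\<close>

lemma det_bordered_mat:
  fixes M :: "'a::idom mat"
  assumes M: "M \<in> carrier_mat k k" and u: "u \<in> carrier_vec k" and w: "w \<in> carrier_vec k"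
  shows "det (bordered_mat M u (M\<^sup>T *\<^sub>v w) a) = det M * (a - w \<bullet> u)"
proof -
  define v where "v = M\<^sup>T *\<^sub>v w"
  define U where "U = mat_of_cols k [u]"
  define V where "V = mat_of_rows k [v]"
  define W where "W = mat_of_rows k [- w]"
  define P where "P = four_block_mat (1\<^sub>m k) (0\<^sub>m k 1) W (1\<^sub>m 1)"
  define c where "c = mat 1 1 (\<lambda>_. a :: 'a)"
  have car: "U \<in> carrier_mat k 1" "V \<in> carrier_mat 1 k" "W \<in> carrier_mat 1 k"
    "c \<in> carrier_mat 1 1"
    by (auto simp: U_def V_def W_def c_def)
  have bord: "bordered_mat M u v a = four_block_mat M U V c"
    using M by (simp add: bordered_mat_def U_def V_def c_def)
  have v_i: "v $ i = w \<bullet> col M i" if "i < k" for i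
    using M w that by (simp add: v_def comm_scalar_prod[of _ k])
  have cleared: "W * M + 1\<^sub>m 1 * V = 0\<^sub>m 1 k"
  proof (rule eq_matI)
    fix i j assume "i < dim_row (0\<^sub>m 1 k :: 'a mat)" "j < dim_col (0\<^sub>m 1 k :: 'a mat)"
    then show "(W * M + 1\<^sub>m 1 * V) $$ (i, j) = 0\<^sub>m 1 k $$ (i, j)"
      using M w car v_i[of j] by (simp add: W_def V_def mat_of_rows_index)
  qed (use M car in auto)
  have corner: "W * U + 1\<^sub>m 1 * c = mat 1 1 (\<lambda>_. a - w \<bullet> u)"
    by (rule eq_matI) (use u w car in \<open>auto simp: W_def U_def c_def\<close>)
  have "P * four_block_mat M U V c =
      four_block_mat (1\<^sub>m k * M + 0\<^sub>m k 1 * V) (1\<^sub>m k * U + 0\<^sub>m k 1 * c)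
        (W * M + 1\<^sub>m 1 * V) (W * U + 1\<^sub>m 1 * c)"
    unfolding P_def by (rule mult_four_block_mat) (use M car in auto)
  also have "\<dots> = four_block_mat M U (0\<^sub>m 1 k) (mat 1 1 (\<lambda>_. a - w \<bullet> u))"
    unfolding cleared corner using M car by simp
  finally have "det P * det (bordered_mat M u v a) =
      det (four_block_mat M U (0\<^sub>m 1 k) (mat 1 1 (\<lambda>_. a - w \<bullet> u)))"
    unfolding bord P_def
    by (subst det_mult[symmetric, of _ "k + 1"]) (use M car in auto)
  also have "\<dots> = det M * (a - w \<bullet> u)"
    by (subst det_four_block_mat_lower_left_zero[OF M car(1) refl])
      (auto simp: det_single)
  also have "det P = 1"
    unfolding P_def
    by (subst det_four_block_mat_upper_right_zero[OF _ refl car(3)]) auto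
  finally show ?thesis by (simp add: v_def)
qed

section \<open>Residuals of the condensed equations\<close>

text \<open>After subtracting the combination \<open>w\<close> of the rows in \<open>I\<close> from row \<open>p\<close>, the entries in the columns
  \<open>J\<close> vanish and those in the remaining columns are, up to the factor \<open>det A\<^sub>0\<close>, the condensed entries.
  This is why the unknowns \<open>x\<^sub>J\<close> drop out of the left-hand side.\<close>

lemma condensed_residual:
  fixes A :: "'a::idom mat"
  assumes A: "A \<in> carrier_mat m n"
    and I: "ordered_index_list m I" and J: "ordered_index_list n J"
    and len: "length I = length J"
    and p: "p < m" and x: "x \<in> carrier_vec n"
    and w: "w \<in> carrier_vec (length I)"
    and combination: "(list_submatrix A I J)\<^sup>T *\<^sub>v w = subvec (row A p) J"
  shows "(\<Sum>s = 0..<length (complement_list n J).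
            condensed_entry A I J p (complement_list n J ! s) * x $ (complement_list n J ! s))
          - condensed_rhs_entry A b I J p =
        det (list_submatrix A I J) *
          ((row A p \<bullet> x - b $ p) - (\<Sum>r = 0..<length I. w $ r * (row A (I ! r) \<bullet> x - b $ (I ! r))))"
proof -
  let ?D = "det (list_submatrix A I J)"
  define g where "g q = A $$ (p, q) - (\<Sum>r = 0..<length I. w $ r * A $$ (I ! r, q))" for q
  have M: "list_submatrix A I J \<in> carrier_mat (length I) (length I)"
    using list_submatrix_carrier[OF A I J] len by simp
  have Ir: "I ! r < m" if "r < length I" for r
    using ordered_index_list_nth_less[OF I that] .
  have entry: "condensed_entry A I J p q = ?D * g q" if "q < n" for q
  proof -
    have "condensed_entry A I J p q = ?D * (A $$ (p, q) - w \<bullet> subvec (col A q) I)"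
      unfolding condensed_entry_def combination[symmetric]
      by (rule det_bordered_mat[OF M _ w]) (simp add: subvec_def)
    also have "w \<bullet> subvec (col A q) I = (\<Sum>r = 0..<length I. w $ r * A $$ (I ! r, q))"
      using A that Ir by (auto simp: scalar_prod_def subvec_def intro!: sum.cong)
    finally show ?thesis by (simp add: g_def)
  qed
  have rhs: "condensed_rhs_entry A b I J p =
      ?D * (b $ p - (\<Sum>r = 0..<length I. w $ r * b $ (I ! r)))"
  proof -
    have "condensed_rhs_entry A b I J p = ?D * (b $ p - w \<bullet> subvec b I)"
      unfolding condensed_rhs_entry_def combination[symmetric]
      by (rule det_bordered_mat[OF M _ w]) (simp add: subvec_def)
    then show ?thesis by (simp add: scalar_prod_def subvec_def)
  qed
  have g_J: "g (J ! s) = 0" if s: "s < length J" for s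
  proof -
    have "A $$ (p, J ! s) = subvec (row A p) J $ s"
      using A p s ordered_index_list_nth_less[OF J s] by (simp add: subvec_def)
    also have "\<dots> = col (list_submatrix A I J) s \<bullet> w"
      using M s len by (simp add: combination[symmetric])
    also have "\<dots> = (\<Sum>r = 0..<length I. w $ r * A $$ (I ! r, J ! s))"
      using M w s len list_submatrix_index[OF A I J _ s]
      by (auto simp: scalar_prod_def mult.commute intro!: sum.cong)
    finally show ?thesis by (simp add: g_def)
  qed
  have row_sum: "row A i \<bullet> x = (\<Sum>q = 0..<n. A $$ (i, q) * x $ q)" if "i < m" for i
    using A x that by (auto simp: scalar_prod_def intro!: sum.cong)
  have lhs: "(\<Sum>s = 0..<length (complement_list n J). g (complement_list n J ! s) * x $ (complement_list n J ! s))
      = row A p \<bullet> x - (\<Sum>r = 0..<length I. w $ r * (row A (I ! r) \<bullet> x))"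
  proof -
    have "(\<Sum>s = 0..<length (complement_list n J). g (complement_list n J ! s) * x $ (complement_list n J ! s))
        = (\<Sum>q = 0..<n. g q * x $ q)"
      by (subst sum_split_complement_list[OF J]) (simp add: g_J)
    also have "\<dots> = (\<Sum>q = 0..<n. A $$ (p, q) * x $ q)
        - (\<Sum>q = 0..<n. \<Sum>r = 0..<length I. w $ r * (A $$ (I ! r, q) * x $ q))"
      by (simp add: g_def left_diff_distrib sum_subtractf sum_distrib_right mult.assoc)
    also have "(\<Sum>q = 0..<n. \<Sum>r = 0..<length I. w $ r * (A $$ (I ! r, q) * x $ q))
        = (\<Sum>r = 0..<length I. w $ r * (row A (I ! r) \<bullet> x))"
      by (subst sum.swap) (simp add: row_sum Ir sum_distrib_left)
    finally show ?thesis by (simp add: row_sum p)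
  qed
  have "complement_list n J ! s < n" if "s < length (complement_list n J)" for s
    using nth_mem[OF that] by (simp add: set_complement_list)
  then have "(\<Sum>s = 0..<length (complement_list n J).
        condensed_entry A I J p (complement_list n J ! s) * x $ (complement_list n J ! s))
      = ?D * (row A p \<bullet> x - (\<Sum>r = 0..<length I. w $ r * (row A (I ! r) \<bullet> x)))"
    by (simp add: lhs[symmetric] entry sum_distrib_left mult.assoc)
  then show ?thesis
    by (simp add: rhs right_diff_distrib sum_subtractf algebra_simps)
qed

section \<open>Solving the equations of the pivot rows\<close>

text \<open>The equations in \<open>I\<close> read \<open>A\<^sub>0 x\<^sub>J = b\<^sub>I - A[I;J'] x\<^bsub>J'\<^esub>\<close>, so they can be solved for \<open>x\<^sub>J\<close> whatever
  \<open>x\<^bsub>J'\<^esub>\<close> is.\<close>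

lemma solve_pivot_rows:
  fixes A :: "'a::comm_ring_1 mat"
  assumes A: "A \<in> carrier_mat m n"
    and I: "ordered_index_list m I" and J: "ordered_index_list n J"
    and B: "B \<in> carrier_mat (length J) (length I)"
    and inv: "list_submatrix A I J * B = 1\<^sub>m (length I)"
    and y: "y \<in> carrier_vec (n - length J)"
  obtains x where "x \<in> carrier_vec n" "subvec x (complement_list n J) = y"
    "\<And>r. r < length I \<Longrightarrow> row A (I ! r) \<bullet> x = b $ (I ! r)"
proof -
  define J' where "J' = complement_list n J"
  have len: "length J' = n - length J"
    unfolding J'_def by (rule length_complement_list[OF J])
  define c where "c = vec (length I) (\<lambda>r. b $ (I ! r) -
    (\<Sum>s = 0..<length J'. A $$ (I ! r, J' ! s) * y $ s))"
  have c: "c \<in> carrier_vec (length I)" by (simp add: c_def)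
  have M: "list_submatrix A I J \<in> carrier_mat (length I) (length J)"
    using list_submatrix_carrier[OF A I J] .
  have "B *\<^sub>v c \<in> carrier_vec (length J)" using B c by simp
  then obtain x where x: "x \<in> carrier_vec n" "subvec x J = B *\<^sub>v c" "subvec x J' = y"
    using exists_vec_with_subvecs[OF J _ y] unfolding J'_def by metis
  have "list_submatrix A I J *\<^sub>v (B *\<^sub>v c) = c"
    using assoc_mult_mat_vec[OF M B c] inv c by simp
  then have solved: "list_submatrix A I J *\<^sub>v subvec x J = c" by (simp add: x(2))
  have "row A (I ! r) \<bullet> x = b $ (I ! r)" if r: "r < length I" for r
  proof -
    have Ir: "I ! r < m" by (rule ordered_index_list_nth_less[OF I r])
    have "row A (I ! r) \<bullet> x = (\<Sum>q = 0..<n. A $$ (I ! r, q) * x $ q)"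
      using A x(1) Ir by (auto simp: scalar_prod_def intro!: sum.cong)
    also have "\<dots> = (\<Sum>s = 0..<length J. A $$ (I ! r, J ! s) * x $ (J ! s))
        + (\<Sum>s = 0..<length J'. A $$ (I ! r, J' ! s) * x $ (J' ! s))"
      unfolding J'_def by (rule sum_split_complement_list[OF J])
    also have "(\<Sum>s = 0..<length J. A $$ (I ! r, J ! s) * x $ (J ! s))
        = (list_submatrix A I J *\<^sub>v subvec x J) $ r"
      using M r list_submatrix_index[OF A I J r]
      by (auto simp: scalar_prod_def subvec_def intro!: sum.cong)
    also have "\<dots> = b $ (I ! r) - (\<Sum>s = 0..<length J'. A $$ (I ! r, J' ! s) * y $ s)"
      using r by (simp add: solved c_def)
    also have "(\<Sum>s = 0..<length J'. A $$ (I ! r, J' ! s) * x $ (J' ! s))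
        = (\<Sum>s = 0..<length J'. A $$ (I ! r, J' ! s) * y $ s)"
      by (simp add: x(3)[symmetric] subvec_def)
    finally show ?thesis by simp
  qed
  with x that show thesis unfolding J'_def by blast
qed

section \<open>Equivalence of the two systems\<close>

theorem corollary2p4:
  fixes A :: "'a::field mat" and b :: "'a vec" and n k :: nat and I J :: "nat list"
  assumes "A \<in> carrier_mat n n" and "b \<in> carrier_vec n" and "k < n"
    and "ordered_index_list n I" and "length I = k"
    and "ordered_index_list n J" and "length J = k"
    and "invertible_mat (list_submatrix A I J)"
  shows "\<forall>y \<in> carrier_vec (n - k).
    condensed_mat A I J *\<^sub>v y = condensed_rhs A b I J \<longleftrightarrow>
    (\<exists>x \<in> carrier_vec n. A *\<^sub>v x = b \<and> subvec x (complement_list n J) = y)"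
proof
  fix y :: "'a vec" assume y: "y \<in> carrier_vec (n - k)"
  note A = assms(1) and b = assms(2) and I = assms(4) and J = assms(6)
  define M where "M = list_submatrix A I J"
  define I' J' where "I' = complement_list n I" and "J' = complement_list n J"
  have len: "length I' = n - k" "length J' = n - k"
    using length_complement_list[OF I] length_complement_list[OF J] assms(5,7)
    by (simp_all add: I'_def J'_def)
  have M: "M \<in> carrier_mat k k"
    using list_submatrix_carrier[OF A I J] assms(5,7) by (simp add: M_def)
  from assms(8) obtain B where "inverts_mat M B" "inverts_mat B M"
    unfolding M_def invertible_mat_def by blast
  then have MB: "M * B = 1\<^sub>m k" and BM: "B * M = 1\<^sub>m (dim_row B)"
    using M by (simp_all add: inverts_mat_def)
  have B: "B \<in> carrier_mat k k"
    using arg_cong[OF MB, of dim_col] arg_cong[OF BM, of dim_col] M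
    by (intro carrier_matI) simp_all
  with BM have BM: "B * M = 1\<^sub>m k" by simp
  have "det M * det B = 1"
    using det_mult[OF M B] MB by simp
  then have D: "det M \<noteq> 0" by auto
  \<comment> \<open>The transpose of \<open>B\<close> inverts that of \<open>M\<close>, so these are the coefficients of the combination of
    the rows in \<open>I\<close> that agrees with row \<open>p\<close> on \<open>J\<close>.\<close>
  define w where "w p = B\<^sup>T *\<^sub>v subvec (row A p) J" for p
  have w_car: "w p \<in> carrier_vec (length I)" for p
    using B assms(5) by (intro carrier_vecI) (simp add: w_def)
  have w_comb: "(list_submatrix A I J)\<^sup>T *\<^sub>v w p = subvec (row A p) J" for p
  proof -
    have v: "subvec (row A p) J \<in> carrier_vec k"
      using assms(7) by (simp add: subvec_def)
    have "M\<^sup>T *\<^sub>v w p = (M\<^sup>T * B\<^sup>T) *\<^sub>v subvec (row A p) J"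
      unfolding w_def using M B v by (subst assoc_mult_mat_vec[of _ k k _ k]) auto
    also have "M\<^sup>T * B\<^sup>T = 1\<^sub>m k"
      using transpose_mult[OF B M] BM by simp
    finally show ?thesis using v by (simp add: M_def)
  qed
  have residual: "(condensed_mat A I J *\<^sub>v subvec x J') $ r - condensed_rhs A b I J $ r =
      det M * ((row A (I' ! r) \<bullet> x - b $ (I' ! r)) -
        (\<Sum>t = 0..<length I. w (I' ! r) $ t * (row A (I ! t) \<bullet> x - b $ (I ! t))))"
    if x: "x \<in> carrier_vec n" and r: "r < n - k" for x r
  proof -
    have "I' ! r < n"
      using nth_mem[of r I'] r len by (simp add: I'_def set_complement_list)
    from condensed_residual[OF A I J _ this x w_car w_comb, of b] assms(5,7) r len A
    show ?thesis
      by (simp add: M_def condensed_mat_def condensed_rhs_def Let_def scalar_prod_def subvec_def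
          flip: I'_def J'_def)
  qed
  have dims: "dim_row (condensed_mat A I J) = n - k" "dim_vec (condensed_rhs A b I J) = n - k"
    using A len by (simp_all add: condensed_mat_def condensed_rhs_def Let_def flip: I'_def)
  show "condensed_mat A I J *\<^sub>v y = condensed_rhs A b I J \<longleftrightarrow>
    (\<exists>x \<in> carrier_vec n. A *\<^sub>v x = b \<and> subvec x (complement_list n J) = y)"
  proof
    assume sol: "condensed_mat A I J *\<^sub>v y = condensed_rhs A b I J"
    have "y \<in> carrier_vec (n - length J)" using y assms(7) by simp
    from solve_pivot_rows[OF A I J _ _ this, of B b]
    obtain x where x: "x \<in> carrier_vec n" "subvec x J' = y"
      and pivot: "\<And>r. r < length I \<Longrightarrow> row A (I ! r) \<bullet> x = b $ (I ! r)"
      using B MB assms(5,7) unfolding M_def J'_def by metis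
    have "row A i \<bullet> x = b $ i" if i: "i < n" for i
    proof (cases "i \<in> set I")
      case True
      then show ?thesis using pivot by (auto simp: in_set_conv_nth)
    next
      case False
      then have "i \<in> set I'" using i by (simp add: I'_def set_complement_list)
      then obtain r where r: "r < n - k" "I' ! r = i"
        using len by (auto simp: in_set_conv_nth)
      have "det M * (row A i \<bullet> x - b $ i) = 0"
        using residual[OF x(1) r(1)] sol pivot by (simp add: x(2) r(2))
      then show ?thesis using D by simp
    qed
    then have "A *\<^sub>v x = b"
      using A b by (intro eq_vecI) auto
    with x show "\<exists>x \<in> carrier_vec n. A *\<^sub>v x = b \<and> subvec x (complement_list n J) = y"
      by (auto simp: J'_def)
  next
    assume "\<exists>x \<in> carrier_vec n. A *\<^sub>v x = b \<and> subvec x (complement_list n J) = y"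
    then obtain x where x: "x \<in> carrier_vec n" "A *\<^sub>v x = b" "subvec x J' = y"
      by (auto simp: J'_def)
    have zero: "row A i \<bullet> x - b $ i = 0" if "i < n" for i
      using A that by (simp add: x(2)[symmetric])
    show "condensed_mat A I J *\<^sub>v y = condensed_rhs A b I J"
    proof (rule eq_vecI)
      fix r assume "r < dim_vec (condensed_rhs A b I J)"
      then have r: "r < n - k" by (simp add: dims)
      have "I' ! r < n"
        using nth_mem[of r I'] r len by (simp add: I'_def set_complement_list)
      then have "(condensed_mat A I J *\<^sub>v y) $ r - condensed_rhs A b I J $ r = 0"
        using residual[OF x(1) r] by (simp add: x(3) zero ordered_index_list_nth_less[OF I])
      then show "(condensed_mat A I J *\<^sub>v y) $ r = condensed_rhs A b I J $ r" by simp
    qed (simp add: dims)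
  qed
qed

end
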